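(* The property of being a split graph admits a size-oblivious one-sided error tester with query complexity $\widetilde O(1/\varepsilon^6)$.
   Context: A graph is a finite simple labelled graph; a split graph is a graph whose vertex set can be partitioned into one independent set and one clique (empty parts allowed). Distance: for graphs $G,G'$ on the same $n$-element vertex set, $\mathrm{dist}(G,G')=|E(G)\triangle E(G')|/n^2$; $G$ is $\varepsilon$-far from a graph property $\Pi$ if the minimum of $\mathrm{dist}(G,G')$ over $G'\in\Pi$ with $V(G')=V(G)$ exceeds $\varepsilon$. A size-oblivious tester for $\Pi$ is a randomized oracle algorithm which, given $\varepsilon>0$ but not $|V(G)|$, has oracle access to the adjacency predicate of $G$ and to independent uniform samples from $V(G)$ (a request for a sample larger than the input being interpreted as a request to inspect the whole graph), accepts every $G\in\Pi$ with probability at least $2/3$, and rejects every $G$ that is $\varepsilon$-far from $\Pi$ with probability at least $2/3$. Its query complexity is the maximum number of adjacency queries and its sample complexity the maximum number of vertex labels inspected; both must be bounded in terms of $\varepsilon$ only. It has one-sided error if it accepts every graph in $\Pi$ with probability one. $\widetilde O(\cdot)$ hides polylogarithmic factors in the displayed quantities. *)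

theory Defs
  imports "HOL-Probability.Probability" "HOL-Library.Landau_Symbols"
begin

record 'v ugraph =
  verts :: "'v set"
  edges :: "'v set set"

definition simple_graph :: "'v ugraph \<Rightarrow> bool" where
  "simple_graph G \<longleftrightarrow> finite (verts G) \<and> edges G \<subseteq> {e. e \<subseteq> verts G \<and> card e = 2}"

definition independent_set :: "'v ugraph \<Rightarrow> 'v set \<Rightarrow> bool" where
  "independent_set G I \<longleftrightarrow> I \<subseteq> verts G \<and> (\<forall>u\<in>I. \<forall>v\<in>I. {u, v} \<notin> edges G)"

definition clique :: "'v ugraph \<Rightarrow> 'v set \<Rightarrow> bool" where
  "clique G K \<longleftrightarrow> K \<subseteq> verts G \<and> (\<forall>u\<in>K. \<forall>v\<in>K. u \<noteq> v \<longrightarrow> {u, v} \<in> edges G)"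

definition split_graph :: "'v ugraph \<Rightarrow> bool" where
  "split_graph G \<longleftrightarrow> simple_graph G \<and>
     (\<exists>I K. I \<union> K = verts G \<and> I \<inter> K = {} \<and> independent_set G I \<and> clique G K)"

definition graph_dist :: "'v ugraph \<Rightarrow> 'v ugraph \<Rightarrow> real" where
  "graph_dist G G' =
     real (card ((edges G - edges G') \<union> (edges G' - edges G))) / (real (card (verts G)))\<^sup>2"

text \<open>
  Only finitely many graphs share the vertex set of \<open>G\<close>, so this says that the minimum distance
  to the property exceeds \<open>\<epsilon>\<close>; the minimum over no graphs at all is read as infinity.
\<close>
definition far_from :: "('v ugraph \<Rightarrow> bool) \<Rightarrow> real \<Rightarrow> 'v ugraph \<Rightarrow> bool" where
  "far_from P \<epsilon> G \<longleftrightarrow>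
     (\<forall>G'. simple_graph G' \<and> P G' \<and> verts G' = verts G \<longrightarrow> graph_dist G G' > \<epsilon>)"

text \<open>
  A request for \<open>s\<close> vertices is answered by \<open>s\<close> independent uniform vertices if the graph has at
  least \<open>s\<close> vertices, and by the entire vertex set otherwise. The two kinds of answer can be told
  apart. Inspecting the edges of the whole graph still costs adjacency queries.
\<close>
datatype 'v reply = Samples "'v list" | Whole "'v set"

definition sample_oracle :: "'v ugraph \<Rightarrow> nat \<Rightarrow> 'v reply pmf" where
  "sample_oracle G s =
     (if s \<le> card (verts G) then map_pmf Samples (replicate_pmf s (pmf_of_set (verts G)))
      else return_pmf (Whole (verts G)))"

fun revealed :: "'v reply \<Rightarrow> 'v set" where
  "revealed (Samples vs) = set vs"
| "revealed (Whole V) = V"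

fun num_labels :: "'v reply \<Rightarrow> nat" where
  "num_labels (Samples vs) = length vs"
| "num_labels (Whole V) = card V"

text \<open>
  An adaptive algorithm is a well-founded decision tree: it announces its verdict, tosses a fair
  coin, asks whether two vertices are adjacent, or requests a number of sampled vertices.
  What it learns about the number of vertices comes only from the answers to its requests.
\<close>
datatype 'v algorithm =
    Verdict bool
  | Toss "bool \<Rightarrow> 'v algorithm"
  | Query 'v 'v "bool \<Rightarrow> 'v algorithm"
  | Request nat "'v reply \<Rightarrow> 'v algorithm"

datatype outcome = Outcome (accepts: bool) (queries: nat) (labels: nat)

fun charge :: "nat \<Rightarrow> nat \<Rightarrow> outcome \<Rightarrow> outcome" where
  "charge q l (Outcome b q' l') = Outcome b (q + q') (l + l')"

text \<open>
  \<open>S\<close> is the set of labels seen so far. The vertex set is unknown to the algorithm, so adjacency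
  is only disclosed for labels in \<open>S\<close>; any other query is answered negatively (and still counted).
\<close>
primrec run :: "'v algorithm \<Rightarrow> 'v ugraph \<Rightarrow> 'v set \<Rightarrow> outcome pmf" where
  "run (Verdict b) G S = return_pmf (Outcome b 0 0)"
| "run (Toss k) G S = bind_pmf (bernoulli_pmf (1/2)) (\<lambda>c. run (k c) G S)"
| "run (Query u v k) G S =
     map_pmf (charge 1 0) (run (k (u \<in> S \<and> v \<in> S \<and> {u, v} \<in> edges G)) G S)"
| "run (Request s k) G S = bind_pmf (sample_oracle G s)
     (\<lambda>r. map_pmf (charge 0 (num_labels r)) (run (k r) G (S \<union> revealed r)))"

definition prob_accept :: "'v algorithm \<Rightarrow> 'v ugraph \<Rightarrow> real" where
  "prob_accept A G = measure_pmf.prob (run A G {}) {x. accepts x}"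

definition prob_reject :: "'v algorithm \<Rightarrow> 'v ugraph \<Rightarrow> real" where
  "prob_reject A G = measure_pmf.prob (run A G {}) {x. \<not> accepts x}"

definition query_complexity :: "'v algorithm \<Rightarrow> enat" where
  "query_complexity A =
     (SUP G\<in>{G. simple_graph G}. SUP x\<in>set_pmf (run A G {}). enat (queries x))"

definition sample_complexity :: "'v algorithm \<Rightarrow> enat" where
  "sample_complexity A =
     (SUP G\<in>{G. simple_graph G}. SUP x\<in>set_pmf (run A G {}). enat (labels x))"

text \<open>
  The algorithm \<open>T \<epsilon>\<close> depends on the proximity parameter only, and its complexities are
  suprema over graphs of all sizes, hence their finiteness means bounds in terms of \<open>\<epsilon>\<close> alone.
\<close>
definition size_oblivious_tester :: "('v ugraph \<Rightarrow> bool) \<Rightarrow> (real \<Rightarrow> 'v algorithm) \<Rightarrow> bool" where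
  "size_oblivious_tester P T \<longleftrightarrow>
     (\<forall>\<epsilon>>0. query_complexity (T \<epsilon>) < \<infinity> \<and> sample_complexity (T \<epsilon>) < \<infinity> \<and>
       (\<forall>G. simple_graph G \<longrightarrow>
          (P G \<longrightarrow> prob_accept (T \<epsilon>) G \<ge> 2/3) \<and>
          (far_from P \<epsilon> G \<longrightarrow> prob_reject (T \<epsilon>) G \<ge> 2/3)))"

definition one_sided_error :: "('v ugraph \<Rightarrow> bool) \<Rightarrow> (real \<Rightarrow> 'v algorithm) \<Rightarrow> bool" where
  "one_sided_error P T \<longleftrightarrow>
     (\<forall>\<epsilon>>0. \<forall>G. simple_graph G \<and> P G \<longrightarrow> prob_accept (T \<epsilon>) G = 1)"

definition soft_bigo :: "'a filter \<Rightarrow> ('a \<Rightarrow> real) \<Rightarrow> ('a \<Rightarrow> real) set" where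
  "soft_bigo F g = (\<Union>k::nat. O[F](\<lambda>x. g x * ln (g x) ^ k))"

end

theory Submission
  imports Defs
begin

text \<open>
  The tester inspects the subgraph induced by a sample of \<open>s = \<lceil>10 / \<epsilon>\<^sup>2\<rceil>\<close> vertices (or the whole graph, if it
  is smaller) and accepts iff that subgraph is split. Split graphs are closed under induced subgraphs,
  so it never rejects one, and it makes at most \<open>s\<^sup>2 = O(1 / \<epsilon>\<^sup>4)\<close> queries. What needs proof is that a
  sample from a graph that is \<open>\<epsilon>\<close>-far is unlikely to be split.

  The key is that the number of pairs violating a partition of the vertices into a clique part \<open>K\<close> and
  an independent part \<open>I\<close> depends on the degrees alone: in the difference between the degree sum over \<open>K\<close>
  and the degree sum over \<open>I\<close>, the edges across cancel (lemma \<open>sum_degrees_diff\<close>). This is the mechanism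
  behind the Hammer-Simeone formula for the splittance of a graph, and it yields a duality. If a graph
  on \<open>n\<close> vertices is split, then \<open>t (n - t) \<le> \<Sum>v. \<bar>deg v - t\<bar>\<close> for every real \<open>t\<close>, up to an error linear in \<open>n\<close>;
  if it is \<open>\<epsilon>\<close>-far, then a single \<open>t\<close> violates this inequality by more than \<open>2 \<epsilon> n\<^sup>2\<close>
  (lemma \<open>far_from_split_threshold\<close>). The number \<open>t\<close> depends on the graph only, so there is no union bound
  over the partitions of the sample: it suffices that one average, the mean absolute deviation of the
  degrees from \<open>t\<close>, is estimated well by the sample.

  The sample can err in three ways: the mean over the sampled vertices differs from the mean over all
  vertices, the degree of a sampled vertex within the sample differs from its scaled true degree, and
  vertices may be drawn repeatedly. The first two errors are sums of orthogonal bounded variables, hence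
  have second moment at most the number of summands; the expected number of coincidences is at most \<open>2 s\<close>
  because \<open>s \<le> n\<close>. Markov's inequality then bounds the probability of a split sample by \<open>1/3\<close>
  (lemma \<open>prob_split_sample_le\<close>).
\<close>

section \<open>Splittance and degrees\<close>

definition adj :: "'v ugraph \<Rightarrow> 'v \<Rightarrow> 'v \<Rightarrow> real" where
  "adj G u v = of_bool ({u, v} \<in> edges G)"

lemma adj_commute: "adj G u v = adj G v u"
  by (simp add: adj_def insert_commute)

lemma adj_bounds: "0 \<le> adj G u v" "adj G u v \<le> 1"
  by (simp_all add: adj_def)

lemma adj_self:
  assumes "simple_graph G"
  shows "adj G v v = 0"
  using assms by (auto simp: adj_def simple_graph_def)

text \<open>
  Rows indexed by \<open>P\<close> and by its complement share the block between \<open>P\<close> and the complement, which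
  by symmetry contributes equally to both sums. The identity serves twice: for the vertices of a graph, and
  for the positions of a sampled list, in which vertices may recur.
\<close>
lemma sum_degrees_diff:
  fixes a :: "'i \<Rightarrow> 'i \<Rightarrow> real"
  assumes "finite J" "P \<subseteq> J" and sym: "\<And>i j. a i j = a j i"
  shows "(\<Sum>i\<in>P. \<Sum>j\<in>J. a i j) - (\<Sum>i\<in>J - P. \<Sum>j\<in>J. a i j) =
         (\<Sum>i\<in>P. \<Sum>j\<in>P. a i j) - (\<Sum>i\<in>J - P. \<Sum>j\<in>J - P. a i j)"
proof -
  have split: "(\<Sum>j\<in>J. f j) = (\<Sum>j\<in>P. f j) + (\<Sum>j\<in>J - P. f j)" for f :: "'i \<Rightarrow> real"
    using sum.subset_diff[OF assms(2,1), of f] by simp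
  have cross: "(\<Sum>i\<in>P. \<Sum>j\<in>J - P. a i j) = (\<Sum>i\<in>J - P. \<Sum>j\<in>P. a i j)"
    by (subst sum.swap) (intro sum.cong refl sym)
  show ?thesis
    by (simp add: split[of "a _"] sum.distrib cross)
qed

lemma card_pairs_eq_sum:
  assumes "finite V" and M: "M \<subseteq> {e. e \<subseteq> V \<and> card e = 2}"
  shows "2 * real (card M) = (\<Sum>u\<in>V. \<Sum>v\<in>V. of_bool ({u, v} \<in> M))"
proof -
  have finM: "finite M"
    by (rule finite_subset[of _ "Pow V"]) (use M \<open>finite V\<close> in auto)
  have two: "(\<Sum>(u, v)\<in>V \<times> V. of_bool ({u, v} = e)) = (2::real)" if e: "e \<in> M" for e
  proof -
    obtain x y where xy: "e = {x, y}" "x \<noteq> y"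
      using M e by (auto simp: card_2_iff)
    have "x \<in> V" "y \<in> V" using M e xy by auto
    have "(\<Sum>(u, v)\<in>V \<times> V. of_bool ({u, v} = e)) = (\<Sum>z\<in>{(x, y), (y, x)}. (1::real))"
      using xy \<open>x \<in> V\<close> \<open>y \<in> V\<close> \<open>finite V\<close>
      by (intro sum.mono_neutral_cong_right) (auto simp: doubleton_eq_iff)
    then show ?thesis using xy by simp
  qed
  have "(\<Sum>u\<in>V. \<Sum>v\<in>V. of_bool ({u, v} \<in> M)) = (\<Sum>(u, v)\<in>V \<times> V. \<Sum>e\<in>M. of_bool ({u, v} = e) :: real)"
    using finM by (simp add: sum.cartesian_product of_bool_def sum.delta)
  also have "\<dots> = (\<Sum>e\<in>M. \<Sum>(u, v)\<in>V \<times> V. of_bool ({u, v} = e))"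
    unfolding split_def by (rule sum.swap)
  also have "\<dots> = 2 * real (card M)"
    using two by simp
  finally show ?thesis by simp
qed

text \<open>
  Deleting all edges inside the complement of \<open>K\<close> and adding all missing edges inside \<open>K\<close> makes the graph
  split, so these changes number more than \<open>\<epsilon> n\<^sup>2\<close>. Twice their number is
  \<open>\<bar>K\<bar> (\<bar>K\<bar> - 1)\<close> minus the difference of the degree sums, by \<open>sum_degrees_diff\<close>; the bound gives away
  the term \<open>\<bar>K\<bar>\<close>.
\<close>
lemma far_from_split_partition:
  assumes G: "simple_graph G" and far: "far_from split_graph \<epsilon> G" and K: "K \<subseteq> verts G"
    and ne: "verts G \<noteq> {}"
  defines "V \<equiv> verts G"
  defines "deg \<equiv> \<lambda>v. \<Sum>w\<in>V. adj G v w"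
  shows "2 * \<epsilon> * (real (card V))\<^sup>2 < (real (card K))\<^sup>2 - ((\<Sum>v\<in>K. deg v) - (\<Sum>v\<in>V - K. deg v))"
proof -
  have finV: "finite V" and E: "edges G \<subseteq> {e. e \<subseteq> V \<and> card e = 2}"
    using G by (auto simp: simple_graph_def V_def)
  have KV: "K \<subseteq> V" using K V_def by simp
  have n0: "real (card V) > 0" using ne finV by (simp add: V_def card_gt_0_iff)
  define I where "I = V - K"
  define A where "A = {e \<in> edges G. e \<subseteq> I}"
  define B where "B = {e. e \<subseteq> K \<and> card e = 2 \<and> e \<notin> edges G}"
  define G' where "G' = \<lparr>verts = V, edges = (edges G - A) \<union> B\<rparr>"
  have sg: "simple_graph G'"
    using finV E KV by (auto simp: simple_graph_def G'_def B_def)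
  have "split_graph G'"
    unfolding split_graph_def
  proof (rule conjI[OF sg], rule exI[of _ I], rule exI[of _ K], intro conjI)
    show "independent_set G' I" "I \<union> K = verts G'" "I \<inter> K = {}"
      using KV by (auto simp: independent_set_def G'_def A_def B_def I_def)
    have "card {u, v} = 2 \<and> {u, v} \<subseteq> K \<and> {u, v} \<notin> A" if "u \<in> K" "v \<in> K" "u \<noteq> v" for u v
      using that by (auto simp: A_def I_def)
    then show "clique G' K"
      using KV by (auto simp: clique_def G'_def B_def)
  qed
  then have "\<epsilon> < graph_dist G G'"
    using far sg by (auto simp: far_from_def G'_def V_def)
  moreover have "(edges G - edges G') \<union> (edges G' - edges G) = A \<union> B"
    by (auto simp: G'_def A_def B_def)
  ultimately have "\<epsilon> * (real (card V))\<^sup>2 < real (card (A \<union> B))"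
    using n0 by (simp add: graph_dist_def V_def field_simps)
  moreover have "2 * real (card (A \<union> B)) = (\<Sum>u\<in>V. \<Sum>v\<in>V. of_bool ({u, v} \<in> A \<union> B))"
    by (rule card_pairs_eq_sum[OF finV]) (use E KV in \<open>auto simp: A_def B_def\<close>)
  \<comment> \<open>The pairs \<open>u = v\<close> in \<open>K\<close> count as changes from here on, which is where \<open>\<bar>K\<bar>\<^sup>2\<close> replaces \<open>\<bar>K\<bar> (\<bar>K\<bar> - 1)\<close>.\<close>
  moreover have "\<dots> \<le> (\<Sum>u\<in>V. \<Sum>v\<in>V. of_bool (u \<in> K \<and> v \<in> K) * (1 - adj G u v)
                      + of_bool (u \<in> I \<and> v \<in> I) * adj G u v)"
    by (intro sum_mono) (auto simp: A_def B_def adj_def)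
  moreover have "\<dots> = (\<Sum>u\<in>K. \<Sum>v\<in>K. 1 - adj G u v) + (\<Sum>u\<in>I. \<Sum>v\<in>I. adj G u v)"
  proof -
    have restrict: "(\<Sum>u\<in>V. \<Sum>v\<in>V. of_bool (u \<in> S \<and> v \<in> S) * f u v) = (\<Sum>u\<in>S. \<Sum>v\<in>S. f u v)"
      if "S \<subseteq> V" for S and f :: "'a \<Rightarrow> 'a \<Rightarrow> real"
    proof -
      have "(\<Sum>u\<in>S. \<Sum>v\<in>S. f u v) = (\<Sum>u\<in>S. \<Sum>v\<in>V. of_bool (u \<in> S \<and> v \<in> S) * f u v)"
        using that finV by (intro sum.cong refl sum.mono_neutral_cong_left) auto
      also have "\<dots> = (\<Sum>u\<in>V. \<Sum>v\<in>V. of_bool (u \<in> S \<and> v \<in> S) * f u v)"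
        using that finV by (intro sum.mono_neutral_cong_left) auto
      finally show ?thesis by simp
    qed
    show ?thesis
      using restrict[OF KV, of "\<lambda>u v. 1 - adj G u v"] restrict[of I "adj G"]
      by (simp add: sum.distrib I_def)
  qed
  moreover have "(\<Sum>v\<in>K. deg v) - (\<Sum>v\<in>V - K. deg v) =
      (\<Sum>u\<in>K. \<Sum>v\<in>K. adj G u v) - (\<Sum>u\<in>I. \<Sum>v\<in>I. adj G u v)"
    unfolding deg_def I_def by (rule sum_degrees_diff[OF finV KV adj_commute])
  ultimately show ?thesis
    by (simp add: sum_subtractf power2_eq_square)
qed

text \<open>
  When \<open>f\<close> is the degree, the functional minimised here is, up to an additive constant, the bound of
  \<open>far_from_split_partition\<close>. Moving a single vertex into or out of a minimiser does not decrease
  it, and this local optimality is the claimed threshold property at the set's own size.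
\<close>
lemma exists_degree_threshold_set:
  fixes f :: "'v \<Rightarrow> real"
  assumes "finite V"
  obtains K where "K \<subseteq> V" "\<And>v. v \<in> K \<Longrightarrow> real (card K) - 1/2 \<le> f v"
    "\<And>v. v \<in> V - K \<Longrightarrow> f v \<le> real (card K) + 1/2"
proof -
  define \<Phi> where "\<Phi> K = (real (card K))\<^sup>2 - 2 * (\<Sum>v\<in>K. f v)" for K
  have "finite (Pow V)" "Pow V \<noteq> {}" using assms by auto
  from arg_min_if_finite(1)[OF this, of \<Phi>] arg_min_least[OF this, of _ \<Phi>]
  obtain K where K: "K \<in> Pow V" and min: "\<And>L. L \<in> Pow V \<Longrightarrow> \<Phi> K \<le> \<Phi> L"
    by blast
  have finK: "finite K" using K assms finite_subset by blast
  show thesis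
  proof (rule that)
    show "K \<subseteq> V" using K by simp
    show "real (card K) - 1/2 \<le> f v" if v: "v \<in> K" for v
    proof -
      have "\<Phi> K \<le> \<Phi> (K - {v})" using K by (intro min) auto
      moreover have "card K > 0" using v finK card_gt_0_iff by blast
      ultimately show ?thesis
        using v finK by (simp add: \<Phi>_def sum_diff1 of_nat_diff power2_eq_square algebra_simps)
    qed
    show "f v \<le> real (card K) + 1/2" if v: "v \<in> V - K" for v
    proof -
      have "\<Phi> K \<le> \<Phi> (insert v K)" using K v by (intro min) auto
      then show ?thesis
        using v finK by (simp add: \<Phi>_def power2_eq_square algebra_simps)
    qed
  qed
qed

text \<open>
  With \<open>t = \<bar>K\<bar>\<close> for a set \<open>K\<close> that consists of the vertices of degree above \<open>t\<close> and some of those of degree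
  exactly \<open>t\<close>, each \<open>\<bar>deg v - t\<bar>\<close> is \<open>deg v - t\<close> on \<open>K\<close> and \<open>t - deg v\<close> elsewhere. The degree
  bound for this one partition thereby becomes a statement about a mean over all vertices.
\<close>
lemma far_from_split_threshold:
  assumes G: "simple_graph G" and far: "far_from split_graph \<epsilon> G" and ne: "verts G \<noteq> {}"
  defines "V \<equiv> verts G"
  defines "n \<equiv> real (card V)"
  obtains t where "0 \<le> t" "t \<le> n"
    "2 * \<epsilon> * n\<^sup>2 < t * (n - t) - (\<Sum>v\<in>V. \<bar>(\<Sum>w\<in>V. adj G v w) - t\<bar>)"
proof -
  have finV: "finite V" using G by (simp add: simple_graph_def V_def)
  \<comment> \<open>Degrees as natural numbers: integrality turns the bounds \<open>t \<plusminus> 1/2\<close> into \<open>t\<close>.\<close>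
  define d where "d v = card {w \<in> V. {v, w} \<in> edges G}" for v
  have d: "(\<Sum>w\<in>V. adj G v w) = real (d v)" for v
    using finV by (simp add: adj_def d_def of_bool_def sum.If_cases Int_def)
  obtain K where K: "K \<subseteq> V" and lo: "\<And>v. v \<in> K \<Longrightarrow> real (card K) - 1/2 \<le> real (d v)"
    and hi: "\<And>v. v \<in> V - K \<Longrightarrow> real (d v) \<le> real (card K) + 1/2"
    using exists_degree_threshold_set[OF finV, of "\<lambda>v. real (d v)"] by blast
  define t where "t = real (card K)"
  have lo': "t \<le> real (d v)" if "v \<in> K" for v using lo[OF that] by (simp add: t_def)
  have hi': "real (d v) \<le> t" if "v \<in> V - K" for v using hi[OF that] by (simp add: t_def)
  have kn: "card K \<le> card V" using K finV by (rule card_mono[rotated])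
  have cI: "real (card (V - K)) = n - t"
    using K finV kn by (simp add: card_Diff_subset finite_subset t_def n_def of_nat_diff)
  have "(\<Sum>v\<in>V. \<bar>real (d v) - t\<bar>) = (\<Sum>v\<in>V - K. \<bar>real (d v) - t\<bar>) + (\<Sum>v\<in>K. \<bar>real (d v) - t\<bar>)"
    by (rule sum.subset_diff[OF K finV])
  also have "(\<Sum>v\<in>V - K. \<bar>real (d v) - t\<bar>) = (\<Sum>v\<in>V - K. t - real (d v))"
    using hi' by (intro sum.cong) auto
  also have "(\<Sum>v\<in>K. \<bar>real (d v) - t\<bar>) = (\<Sum>v\<in>K. real (d v) - t)"
    using lo' by (intro sum.cong) auto
  finally have "(\<Sum>v\<in>V. \<bar>real (d v) - t\<bar>) =
      (\<Sum>v\<in>K. real (d v)) - (\<Sum>v\<in>V - K. real (d v)) + t * (n - t) - t\<^sup>2"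
    by (simp add: sum_subtractf cI power2_eq_square) (simp add: t_def algebra_simps)
  moreover have "2 * \<epsilon> * n\<^sup>2 < t\<^sup>2 - ((\<Sum>v\<in>K. real (d v)) - (\<Sum>v\<in>V - K. real (d v)))"
    using far_from_split_partition[OF G far _ ne, of K] K d by (simp add: V_def n_def t_def)
  ultimately have "2 * \<epsilon> * n\<^sup>2 < t * (n - t) - (\<Sum>v\<in>V. \<bar>(\<Sum>w\<in>V. adj G v w) - t\<bar>)"
    by (simp add: d)
  then show thesis
    using that[of t] kn by (simp add: t_def n_def)
qed

definition induced :: "'v ugraph \<Rightarrow> 'v set \<Rightarrow> 'v ugraph" where
  "induced G W = \<lparr>verts = W, edges = {e \<in> edges G. e \<subseteq> W}\<rparr>"

lemma split_graph_induced:
  assumes G: "split_graph G" and W: "W \<subseteq> verts G"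
  shows "split_graph (induced G W)"
proof -
  obtain I K where "I \<union> K = verts G" "I \<inter> K = {}" "independent_set G I" "clique G K"
    using G by (auto simp: split_graph_def)
  then have "(I \<inter> W) \<union> (K \<inter> W) = W" "(I \<inter> W) \<inter> (K \<inter> W) = {}"
    "independent_set (induced G W) (I \<inter> W)" "clique (induced G W) (K \<inter> W)"
    using W by (auto simp: independent_set_def clique_def induced_def)
  moreover have "simple_graph (induced G W)"
    using G W finite_subset[of W "verts G"]
    by (auto simp: split_graph_def simple_graph_def induced_def)
  ultimately show ?thesis
    unfolding split_graph_def by (metis induced_def ugraph.select_convs(1))
qed

text \<open>
  The converse direction of the duality, for samples with repetitions: if the sample is split, then the degrees
  within it deviate from \<^emph>\<open>every\<close> \<open>t\<close> by at least this much in total. Two positions of the clique part that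
  hold the same vertex are not adjacent, whence the number of coincidences (the diagonal included) is
  subtracted.
\<close>
lemma split_sample_degree_deviation:
  fixes t :: real
  assumes split: "split_graph (induced G (set vs))"
  defines "s \<equiv> length vs"
  shows "t * (real s - t) - (\<Sum>i<s. \<Sum>j<s. of_bool (vs ! i = vs ! j)) \<le>
         (\<Sum>i<s. \<bar>(\<Sum>j<s. adj G (vs ! i) (vs ! j)) - t\<bar>)"
proof -
  obtain I K where IK: "I \<union> K = set vs" and ind: "independent_set (induced G (set vs)) I"
    and cl: "clique (induced G (set vs)) K"
    using split by (auto simp: split_graph_def induced_def)
  define P where "P = {i. i < s \<and> vs ! i \<in> K}"
  define d where "d i = (\<Sum>j<s. adj G (vs ! i) (vs ! j))" for i
  define col :: real where "col = (\<Sum>i<s. \<Sum>j<s. of_bool (vs ! i = vs ! j))"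
  define k where "k = real (card P)"
  have P: "P \<subseteq> {..<s}" by (auto simp: P_def)
  then have finP: "finite P" by (rule finite_subset) simp
  have kn: "card P \<le> s" using card_mono[OF _ P] by simp
  have cI: "real (card ({..<s} - P)) = real s - k"
    using P finP kn by (simp add: card_Diff_subset k_def of_nat_diff)
  have "1 - of_bool (vs ! i = vs ! j) \<le> adj G (vs ! i) (vs ! j)" if "i \<in> P" "j \<in> P" for i j
    using that cl by (auto simp: P_def clique_def induced_def adj_def)
  then have "(\<Sum>i\<in>P. \<Sum>j\<in>P. 1 - of_bool (vs ! i = vs ! j)) \<le> (\<Sum>i\<in>P. \<Sum>j\<in>P. adj G (vs ! i) (vs ! j))"
    by (intro sum_mono) auto
  moreover have "(\<Sum>i\<in>P. \<Sum>j\<in>P. of_bool (vs ! i = vs ! j)) \<le> col"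
  proof -
    have "(\<Sum>i\<in>P. \<Sum>j\<in>P. of_bool (vs ! i = vs ! j) :: real) \<le> (\<Sum>i\<in>P. \<Sum>j<s. of_bool (vs ! i = vs ! j))"
      using P by (intro sum_mono sum_mono2) auto
    also have "\<dots> \<le> col"
      unfolding col_def using P by (intro sum_mono2) (auto intro!: sum_nonneg)
    finally show ?thesis .
  qed
  ultimately have "k\<^sup>2 - col \<le> (\<Sum>i\<in>P. \<Sum>j\<in>P. adj G (vs ! i) (vs ! j))"
    by (simp add: sum_subtractf k_def power2_eq_square)
  moreover have "(\<Sum>i\<in>{..<s} - P. \<Sum>j\<in>{..<s} - P. adj G (vs ! i) (vs ! j)) = 0"
  proof (intro sum.neutral ballI)
    fix i j assume "i \<in> {..<s} - P" "j \<in> {..<s} - P"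
    then have "vs ! i \<in> set vs - K" "vs ! j \<in> set vs - K" by (auto simp: P_def s_def)
    then show "adj G (vs ! i) (vs ! j) = 0"
      using IK ind by (auto simp: independent_set_def induced_def adj_def)
  qed
  moreover have "(\<Sum>i\<in>P. d i) - (\<Sum>i\<in>{..<s} - P. d i) =
      (\<Sum>i\<in>P. \<Sum>j\<in>P. adj G (vs ! i) (vs ! j)) - (\<Sum>i\<in>{..<s} - P. \<Sum>j\<in>{..<s} - P. adj G (vs ! i) (vs ! j))"
    unfolding d_def by (rule sum_degrees_diff[OF _ P]) (auto intro: adj_commute)
  ultimately have main: "k\<^sup>2 - col \<le> (\<Sum>i\<in>P. d i) - (\<Sum>i\<in>{..<s} - P. d i)" by simp
  have "t * (real s - t) - col \<le> (k - t)\<^sup>2 + t * (real s - t) - col" by simp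
  also have "\<dots> = (k\<^sup>2 - col) - t * k + t * (real s - k)"
    by (simp add: power2_eq_square algebra_simps)
  also have "\<dots> \<le> (\<Sum>i\<in>P. d i - t) + (\<Sum>i\<in>{..<s} - P. t - d i)"
    using main by (simp add: sum_subtractf cI) (simp add: k_def algebra_simps)
  also have "\<dots> \<le> (\<Sum>i\<in>P. \<bar>d i - t\<bar>) + (\<Sum>i\<in>{..<s} - P. \<bar>d i - t\<bar>)"
    by (intro add_mono sum_mono) auto
  also have "\<dots> = (\<Sum>i<s. \<bar>d i - t\<bar>)"
    using sum.subset_diff[OF P, of "\<lambda>i. \<bar>d i - t\<bar>"] by simp
  finally show ?thesis
    by (simp add: d_def col_def)
qed

section \<open>Independent samples\<close>

text \<open>
  Redrawing one coordinate does not change the distribution. This is the only form of independence used: it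
  lets the expectation over a chosen coordinate be taken first, whatever the other coordinates are.
\<close>
lemma replicate_pmf_resample:
  assumes "k < s"
  shows "bind_pmf (replicate_pmf s p) (\<lambda>vs. map_pmf (\<lambda>x. vs[k := x]) p) = replicate_pmf s p"
  using assms
proof (induction s arbitrary: k)
  case (Suc s)
  show ?case
  proof (cases k)
    case 0
    have "bind_pmf (replicate_pmf (Suc s) p) (\<lambda>vs. map_pmf (\<lambda>x. vs[k := x]) p) =
        bind_pmf (replicate_pmf s p) (\<lambda>xs. bind_pmf p (\<lambda>x. return_pmf (x # xs)))"
      by (simp add: 0 bind_assoc_pmf bind_return_pmf map_pmf_def)
    also have "\<dots> = replicate_pmf (Suc s) p"
      by (subst bind_commute_pmf) simp
    finally show ?thesis .
  next
    case (Suc l)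
    have "bind_pmf (replicate_pmf (Suc s) p) (\<lambda>vs. map_pmf (\<lambda>x. vs[k := x]) p) =
        bind_pmf p (\<lambda>y. map_pmf (Cons y)
          (bind_pmf (replicate_pmf s p) (\<lambda>vs. map_pmf (\<lambda>x. vs[l := x]) p)))"
      by (simp add: Suc bind_assoc_pmf bind_return_pmf map_pmf_def)
    also have "\<dots> = replicate_pmf (Suc s) p"
      using Suc.IH[of l] Suc.prems Suc by (simp add: map_pmf_def)
    finally show ?thesis .
  qed
qed simp

lemma finite_set_replicate_pmf:
  assumes "finite (set_pmf p)"
  shows "finite (set_pmf (replicate_pmf s p))"
  using finite_lists_length_eq[OF assms, of s]
  by (rule rev_finite_subset) (auto simp: set_replicate_pmf)

lemma expectation_resample:
  fixes F :: "'v list \<Rightarrow> real"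
  assumes fin: "finite (set_pmf p)" and k: "k < s"
  shows "measure_pmf.expectation (replicate_pmf s p) F =
    measure_pmf.expectation (replicate_pmf s p) (\<lambda>vs. measure_pmf.expectation p (\<lambda>x. F (vs[k := x])))"
proof -
  let ?R = "replicate_pmf s p"
  note finR = finite_set_replicate_pmf[OF fin, of s]
  have "measure_pmf.expectation ?R F =
      measure_pmf.expectation (bind_pmf ?R (\<lambda>vs. map_pmf (\<lambda>x. vs[k := x]) p)) F"
    by (simp add: replicate_pmf_resample[OF k])
  also have "\<dots> = (\<Sum>vs\<in>set_pmf ?R. pmf ?R vs *\<^sub>R measure_pmf.expectation (map_pmf (\<lambda>x. vs[k := x]) p) F)"
    by (rule pmf_expectation_bind) (use fin finR in auto)
  also have "\<dots> = measure_pmf.expectation ?R (\<lambda>vs. measure_pmf.expectation p (\<lambda>x. F (vs[k := x])))"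
    by (subst integral_measure_pmf[OF finR]) auto
  finally show ?thesis .
qed

lemma expectation_replicate_pmf_mono:
  fixes f g :: "'v list \<Rightarrow> real"
  assumes "finite (set_pmf p)" and "\<And>vs. length vs = s \<Longrightarrow> f vs \<le> g vs"
  shows "measure_pmf.expectation (replicate_pmf s p) f \<le> measure_pmf.expectation (replicate_pmf s p) g"
  by (rule integral_mono_AE)
     (use assms in \<open>auto simp: AE_measure_pmf_iff set_replicate_pmf
        intro!: integrable_measure_pmf_finite finite_set_replicate_pmf\<close>)

lemma expectation_replicate_pmf_cong:
  fixes f g :: "'v list \<Rightarrow> real"
  assumes "finite (set_pmf p)" and "\<And>vs. length vs = s \<Longrightarrow> f vs = g vs"
  shows "measure_pmf.expectation (replicate_pmf s p) f = measure_pmf.expectation (replicate_pmf s p) g"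
  using assms by (intro antisym expectation_replicate_pmf_mono) auto

text \<open>
  For \<open>i \<noteq> j\<close> the product of \<open>F i\<close> and \<open>F j\<close> has mean zero, because averaging over coordinate \<open>j\<close> alone already
  annihilates \<open>F j\<close> and leaves \<open>F i\<close> fixed; only the diagonal terms remain. Each \<open>F j\<close> may depend on coordinates
  outside \<open>J\<close>, so the lemma also covers the degree of a sampled vertex, where the vertex itself is random.
\<close>
lemma expectation_orthogonal_sum_square_le:
  fixes F :: "nat \<Rightarrow> 'v list \<Rightarrow> real"
  assumes fin: "finite (set_pmf p)" and J: "J \<subseteq> {..<s}"
    and bounded: "\<And>j vs. j \<in> J \<Longrightarrow> length vs = s \<Longrightarrow> \<bar>F j vs\<bar> \<le> 1"
    and centred: "\<And>j vs. j \<in> J \<Longrightarrow> length vs = s \<Longrightarrow> measure_pmf.expectation p (\<lambda>x. F j (vs[j := x])) = 0"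
    and unaffected: "\<And>i j vs x. i \<in> J \<Longrightarrow> j \<in> J \<Longrightarrow> i \<noteq> j \<Longrightarrow> length vs = s \<Longrightarrow> F i (vs[j := x]) = F i vs"
  shows "measure_pmf.expectation (replicate_pmf s p) (\<lambda>vs. (\<Sum>j\<in>J. F j vs)\<^sup>2) \<le> real (card J)"
proof -
  let ?E = "measure_pmf.expectation (replicate_pmf s p)"
  note finR = finite_set_replicate_pmf[OF fin, of s]
  have int: "integrable (measure_pmf (replicate_pmf s p)) f" for f :: "'v list \<Rightarrow> real"
    by (rule integrable_measure_pmf_finite[OF finR])
  have finJ: "finite J" using J finite_subset by blast
  have off: "?E (\<lambda>vs. F i vs * F j vs) = 0" if "i \<in> J" "j \<in> J" "i \<noteq> j" for i j
  proof -
    have "?E (\<lambda>vs. F i vs * F j vs) =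
        ?E (\<lambda>vs. measure_pmf.expectation p (\<lambda>x. F i (vs[j := x]) * F j (vs[j := x])))"
      using that J by (intro expectation_resample[OF fin]) auto
    also have "\<dots> = ?E (\<lambda>vs. 0)"
      by (rule expectation_replicate_pmf_cong[OF fin]) (simp add: that unaffected centred)
    finally show ?thesis by simp
  qed
  have diag: "?E (\<lambda>vs. F j vs * F j vs) \<le> 1" if "j \<in> J" for j
  proof -
    have "?E (\<lambda>vs. F j vs * F j vs) \<le> ?E (\<lambda>vs. 1)"
    proof (rule expectation_replicate_pmf_mono[OF fin])
      fix vs :: "'v list" assume "length vs = s"
      then show "F j vs * F j vs \<le> 1"
        using bounded[OF that, of vs] by (simp add: abs_square_le_1 power2_eq_square[symmetric])
    qed
    then show ?thesis by simp
  qed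
  have "?E (\<lambda>vs. (\<Sum>j\<in>J. F j vs)\<^sup>2) = (\<Sum>i\<in>J. \<Sum>j\<in>J. ?E (\<lambda>vs. F i vs * F j vs))"
    unfolding power2_eq_square sum_product by (subst Bochner_Integration.integral_sum[OF int])+ (rule refl)
  also have "\<dots> = (\<Sum>i\<in>J. ?E (\<lambda>vs. F i vs * F i vs))"
  proof (rule sum.cong[OF refl])
    fix i assume i: "i \<in> J"
    have "(\<Sum>j\<in>J - {i}. ?E (\<lambda>vs. F i vs * F j vs)) = 0"
      using i off by (intro sum.neutral) auto
    then show "(\<Sum>j\<in>J. ?E (\<lambda>vs. F i vs * F j vs)) = ?E (\<lambda>vs. F i vs * F i vs)"
      using sum.remove[OF finJ i, of "\<lambda>j. ?E (\<lambda>vs. F i vs * F j vs)"] by simp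
  qed
  also have "\<dots> \<le> real (card J)"
    using sum_mono[OF diag, of J "\<lambda>j. j"] by simp
  finally show ?thesis .
qed

text \<open>
  This form of the inequality between the arithmetic and geometric means replaces the Cauchy-Schwarz inequality
  in passing from absolute deviations to second moments.
\<close>
lemma abs_le_quarter_plus_square:
  fixes u c :: real
  assumes "0 < c"
  shows "\<bar>u\<bar> \<le> c / 4 + u\<^sup>2 / c"
proof -
  have "0 \<le> (\<bar>u\<bar> - c / 2)\<^sup>2 / c" using assms by simp
  also have "(\<bar>u\<bar> - c / 2)\<^sup>2 / c = c / 4 + u\<^sup>2 / c - \<bar>u\<bar>"
    using assms by (simp add: power2_diff field_simps power2_eq_square)
  finally show ?thesis by simp
qed

text \<open>
  The deterministic half of the sampling argument. Here \<open>d v\<close> stands for the density of the neighbourhood of \<open>v\<close>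
  and \<open>\<mu>\<close> for the mean of \<open>\<bar>d v - \<theta>\<bar>\<close>. Scaled to the sample, a split sample has to make up for the whole
  gap \<open>2 \<epsilon> s\<^sup>2\<close>; the two applications of \<open>abs_le_quarter_plus_square\<close> spend \<open>\<epsilon> s\<^sup>2 / 4\<close> each,
  and the rest is left to the coincidences and to two sums of squares with small expectation.
\<close>
lemma split_sample_statistic_ge:
  fixes p :: "'v pmf" and \<theta> \<epsilon> :: real
  assumes G: "simple_graph G" and \<epsilon>: "0 < \<epsilon>" and s: "0 < s" and len: "length vs = s"
    and split: "split_graph (induced G (set vs))"
    and d: "\<And>v. 0 \<le> d v \<and> d v \<le> 1"
    and gap: "2 * \<epsilon> \<le> \<theta> * (1 - \<theta>) - \<mu>"
  shows "3 / 2 * \<epsilon> * (real s)\<^sup>2 \<le>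
     (\<Sum>i<s. \<Sum>j<s. of_bool (vs ! i = vs ! j)) +
     (\<Sum>i<s. 2 * (\<Sum>j\<in>{..<s} - {i}. adj G (vs ! i) (vs ! j) - d (vs ! i))\<^sup>2 + 2) / (real s * \<epsilon>) +
     (\<Sum>j<s. \<bar>d (vs ! j) - \<theta>\<bar> - \<mu>)\<^sup>2 / \<epsilon>"
proof -
  define S where "S = real s"
  have S: "0 < S" using s by (simp add: S_def)
  define col :: real where "col = (\<Sum>i<s. \<Sum>j<s. of_bool (vs ! i = vs ! j))"
  define A where "A i = (\<Sum>j\<in>{..<s} - {i}. adj G (vs ! i) (vs ! j) - d (vs ! i))" for i
  define X where "X = (\<Sum>j<s. \<bar>d (vs ! j) - \<theta>\<bar> - \<mu>)"
  have dev: "\<bar>(\<Sum>j<s. adj G (vs ! i) (vs ! j)) - \<theta> * S\<bar> \<le>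
      S * \<epsilon> / 4 + (2 * (A i)\<^sup>2 + 2) / (S * \<epsilon>) + S * \<bar>d (vs ! i) - \<theta>\<bar>" if i: "i < s" for i
  proof -
    \<comment> \<open>Position \<open>i\<close> itself contributes \<open>- d (vs ! i)\<close>, which is not centred and has to be split off.\<close>
    have "(\<Sum>j<s. adj G (vs ! i) (vs ! j)) - S * d (vs ! i) =
        (\<Sum>j<s. adj G (vs ! i) (vs ! j) - d (vs ! i))"
      by (simp add: sum_subtractf S_def)
    also have "\<dots> = A i - d (vs ! i)"
      using i sum.remove[of "{..<s}" i "\<lambda>j. adj G (vs ! i) (vs ! j) - d (vs ! i)"]
      by (simp add: A_def adj_self[OF G])
    finally have eq: "(\<Sum>j<s. adj G (vs ! i) (vs ! j)) - S * d (vs ! i) = A i - d (vs ! i)" .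
    have "(d (vs ! i))\<^sup>2 \<le> 1"
      using d[of "vs ! i"] by (simp add: power_le_one)
    moreover have "0 \<le> (A i + d (vs ! i))\<^sup>2" by simp
    ultimately have "(A i - d (vs ! i))\<^sup>2 \<le> 2 * (A i)\<^sup>2 + 2"
      by (simp add: power2_diff power2_sum)
    then have "(A i - d (vs ! i))\<^sup>2 / (S * \<epsilon>) \<le> (2 * (A i)\<^sup>2 + 2) / (S * \<epsilon>)"
      using S \<epsilon> by (intro divide_right_mono) auto
    moreover have "\<bar>A i - d (vs ! i)\<bar> \<le> S * \<epsilon> / 4 + (A i - d (vs ! i))\<^sup>2 / (S * \<epsilon>)"
      using S \<epsilon> by (intro abs_le_quarter_plus_square) simp
    moreover have "\<bar>(\<Sum>j<s. adj G (vs ! i) (vs ! j)) - \<theta> * S\<bar> \<le>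
        \<bar>A i - d (vs ! i)\<bar> + \<bar>S * d (vs ! i) - S * \<theta>\<bar>"
      unfolding eq[symmetric] by (simp add: mult.commute)
    moreover have "\<bar>S * d (vs ! i) - S * \<theta>\<bar> = S * \<bar>d (vs ! i) - \<theta>\<bar>"
      using S by (simp add: right_diff_distrib[symmetric] abs_mult)
    ultimately show ?thesis by linarith
  qed
  have "\<theta> * S * (S - \<theta> * S) - col \<le> (\<Sum>i<s. \<bar>(\<Sum>j<s. adj G (vs ! i) (vs ! j)) - \<theta> * S\<bar>)"
    using split_sample_degree_deviation[OF split, of "\<theta> * S"] by (simp add: len S_def col_def)
  also have "\<dots> \<le> (\<Sum>i<s. S * \<epsilon> / 4 + (2 * (A i)\<^sup>2 + 2) / (S * \<epsilon>) + S * \<bar>d (vs ! i) - \<theta>\<bar>)"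
    by (intro sum_mono dev) simp
  also have "\<dots> = S\<^sup>2 * \<epsilon> / 4 + (\<Sum>i<s. 2 * (A i)\<^sup>2 + 2) / (S * \<epsilon>) + S * (X + S * \<mu>)"
    unfolding sum.distrib[of _ "\<lambda>i. S * \<bar>d (vs ! i) - \<theta>\<bar>"] sum.distrib[of "\<lambda>i. S * \<epsilon> / 4"]
      sum_divide_distrib[symmetric] sum_distrib_left[symmetric]
    by (simp add: X_def sum_subtractf S_def[symmetric] power2_eq_square)
  also have "S * (X + S * \<mu>) \<le> S\<^sup>2 * \<epsilon> / 4 + X\<^sup>2 / \<epsilon> + S\<^sup>2 * \<mu>"
  proof -
    have "S * X \<le> S * (S * \<epsilon> / 4 + X\<^sup>2 / (S * \<epsilon>))"
      using abs_le_quarter_plus_square[of "S * \<epsilon>" X] S \<epsilon> by (intro mult_left_mono) auto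
    also have "\<dots> = S\<^sup>2 * \<epsilon> / 4 + X\<^sup>2 / \<epsilon>"
      using S \<epsilon> by (simp add: field_simps power2_eq_square)
    finally show ?thesis by (simp add: algebra_simps power2_eq_square)
  qed
  finally have "S\<^sup>2 * (\<theta> * (1 - \<theta>) - \<mu>) - S\<^sup>2 * \<epsilon> / 2 \<le>
      col + (\<Sum>i<s. 2 * (A i)\<^sup>2 + 2) / (S * \<epsilon>) + X\<^sup>2 / \<epsilon>"
    by (simp add: algebra_simps power2_eq_square)
  moreover have "S\<^sup>2 * (2 * \<epsilon>) \<le> S\<^sup>2 * (\<theta> * (1 - \<theta>) - \<mu>)"
    using gap by (intro mult_left_mono) auto
  ultimately show ?thesis
    by (simp add: S_def col_def A_def X_def algebra_simps)
qed

text \<open>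
  The statistic of \<open>split_sample_statistic_ge\<close> has expectation at most \<open>2 s + 3 s / \<epsilon>\<close>, whereas on a split sample
  it is at least \<open>3/2 \<epsilon> s\<^sup>2\<close>. Markov's inequality bounds the probability by \<open>1/3\<close> as soon as
  \<open>s \<ge> 4 / \<epsilon> + 6 / \<epsilon>\<^sup>2\<close>, which for \<open>\<epsilon> \<le> 1\<close> follows from \<open>s \<ge> 10 / \<epsilon>\<^sup>2\<close>. The bound on the point masses of \<open>p\<close>
  expresses that the graph has at least \<open>s\<close> vertices and controls the coincidences.
\<close>
lemma prob_split_sample_le:
  fixes p :: "'v pmf" and \<theta> \<epsilon> :: real
  assumes G: "simple_graph G" and fin: "finite (set_pmf p)"
    and \<epsilon>: "0 < \<epsilon>" "\<epsilon> \<le> 1" and s: "10 / \<epsilon>\<^sup>2 \<le> real s"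
    and spread: "\<And>x. pmf p x \<le> 1 / real s"
    and \<theta>: "0 \<le> \<theta>" "\<theta> \<le> 1"
    and gap: "2 * \<epsilon> \<le> \<theta> * (1 - \<theta>) -
      measure_pmf.expectation p (\<lambda>v. \<bar>measure_pmf.expectation p (adj G v) - \<theta>\<bar>)"
  shows "measure_pmf.prob (replicate_pmf s p) {vs. split_graph (induced G (set vs))} \<le> 1/3"
proof -
  let ?R = "replicate_pmf s p"
  let ?E = "measure_pmf.expectation ?R"
  note finR = finite_set_replicate_pmf[OF fin, of s]
  have int: "integrable (measure_pmf ?R) f" for f :: "'v list \<Rightarrow> real"
    by (rule integrable_measure_pmf_finite[OF finR])
  have intp: "integrable (measure_pmf p) f" for f :: "'v \<Rightarrow> real"
    by (rule integrable_measure_pmf_finite[OF fin])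
  have mean01: "0 \<le> measure_pmf.expectation p f \<and> measure_pmf.expectation p f \<le> 1"
    if "\<And>x. 0 \<le> f x \<and> f x \<le> 1" for f :: "'v \<Rightarrow> real"
    using that integral_mono[OF intp intp, of f "\<lambda>_. 1"] by (auto intro!: integral_nonneg)
  define d where "d v = measure_pmf.expectation p (adj G v)" for v
  define h where "h v = \<bar>d v - \<theta>\<bar>" for v
  define \<mu> where "\<mu> = measure_pmf.expectation p h"
  have d01: "0 \<le> d v \<and> d v \<le> 1" for v
    unfolding d_def by (rule mean01) (simp add: adj_bounds)
  have h01: "0 \<le> h v \<and> h v \<le> 1" for v
    using d01[of v] \<theta> by (auto simp: h_def)
  have \<mu>01: "0 \<le> \<mu> \<and> \<mu> \<le> 1"
    unfolding \<mu>_def by (rule mean01) (rule h01)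
  have gap': "2 * \<epsilon> \<le> \<theta> * (1 - \<theta>) - \<mu>"
  proof -
    have "h = (\<lambda>v. \<bar>measure_pmf.expectation p (adj G v) - \<theta>\<bar>)"
      by (simp add: fun_eq_iff h_def d_def)
    then show ?thesis using gap by (simp add: \<mu>_def)
  qed
  have "0 < 10 / \<epsilon>\<^sup>2" using \<epsilon> by simp
  then have s0: "0 < real s" using s by linarith
  define col :: "'v list \<Rightarrow> real" where "col vs = (\<Sum>i<s. \<Sum>j<s. of_bool (vs ! i = vs ! j))" for vs
  define A where "A i vs = (\<Sum>j\<in>{..<s} - {i}. adj G (vs ! i) (vs ! j) - d (vs ! i))" for i and vs :: "'v list"
  define X where "X vs = (\<Sum>j<s. h (vs ! j) - \<mu>)" for vs :: "'v list"
  define Q where "Q vs = col vs + (\<Sum>i<s. 2 * (A i vs)\<^sup>2 + 2) / (real s * \<epsilon>) + (X vs)\<^sup>2 / \<epsilon>" for vs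
  have Q_ge: "3 / 2 * \<epsilon> * (real s)\<^sup>2 \<le> Q vs" if "split_graph (induced G (set vs))" "length vs = s" for vs
    using split_sample_statistic_ge[OF G \<epsilon>(1) _ that(2,1) d01 gap'] s0
    by (simp add: Q_def col_def A_def X_def h_def)
  have EX: "?E (\<lambda>vs. (X vs)\<^sup>2) \<le> real s"
  proof -
    have "\<bar>h v - \<mu>\<bar> \<le> 1" for v using h01[of v] \<mu>01 by auto
    then have "?E (\<lambda>vs. (X vs)\<^sup>2) \<le> real (card {..<s})"
      unfolding X_def
      by (intro expectation_orthogonal_sum_square_le[OF fin])
         (auto simp: Bochner_Integration.integral_diff[OF intp intp] \<mu>_def)
    then show ?thesis by simp
  qed
  have EA: "?E (\<lambda>vs. (A i vs)\<^sup>2) \<le> real s - 1" if i: "i < s" for i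
  proof -
    have "\<bar>adj G u v - d u\<bar> \<le> 1" for u v
      using d01[of u] adj_bounds[of G u v] by (simp add: abs_le_iff)
    then have "?E (\<lambda>vs. (A i vs)\<^sup>2) \<le> real (card ({..<s} - {i}))"
      unfolding A_def
      by (intro expectation_orthogonal_sum_square_le[OF fin])
         (auto simp: Bochner_Integration.integral_diff[OF intp intp] d_def)
    then show ?thesis using i by (simp add: of_nat_diff)
  qed
  have Ecol: "?E col \<le> 2 * real s"
  proof -
    have pair: "?E (\<lambda>vs. of_bool (vs ! i = vs ! j)) \<le> 1 / real s" if ij: "i < s" "j < s" "i \<noteq> j" for i j
    proof -
      have "?E (\<lambda>vs. of_bool (vs ! i = vs ! j)) =
          ?E (\<lambda>vs. measure_pmf.expectation p (\<lambda>x. of_bool (vs[j := x] ! i = vs[j := x] ! j) :: real))"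
        by (rule expectation_resample[OF fin ij(2)])
      also have "\<dots> \<le> ?E (\<lambda>vs. 1 / real s)"
      proof (rule expectation_replicate_pmf_mono[OF fin])
        fix vs :: "'v list" assume "length vs = s"
        then have "measure_pmf.expectation p (\<lambda>x. of_bool (vs[j := x] ! i = vs[j := x] ! j)) =
            measure_pmf.expectation p (indicator {vs ! i})"
          using ij by (intro Bochner_Integration.integral_cong) (auto simp: indicator_def)
        also have "\<dots> \<le> 1 / real s"
          using spread[of "vs ! i"] by (simp add: measure_pmf_single)
        finally show "measure_pmf.expectation p (\<lambda>x. of_bool (vs[j := x] ! i = vs[j := x] ! j)) \<le> 1 / real s" .
      qed
      finally show ?thesis by simp
    qed
    have "?E col = (\<Sum>i<s. \<Sum>j<s. ?E (\<lambda>vs. of_bool (vs ! i = vs ! j)))"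
      unfolding col_def by (simp only: Bochner_Integration.integral_sum int)
    also have "\<dots> \<le> (\<Sum>i<s. \<Sum>j<s. of_bool (i = j) + 1 / real s)"
      using pair by (intro sum_mono) (auto simp: of_bool_def)
    also have "\<dots> = 2 * real s"
      using s0 by (simp add: sum.distrib of_bool_def)
    finally show ?thesis .
  qed
  have EQ: "?E Q \<le> 2 * real s + 3 * real s / \<epsilon>"
  proof -
    have "?E Q = ?E col + (\<Sum>i<s. 2 * ?E (\<lambda>vs. (A i vs)\<^sup>2) + 2) / (real s * \<epsilon>) + ?E (\<lambda>vs. (X vs)\<^sup>2) / \<epsilon>"
      unfolding Q_def by (simp add: Bochner_Integration.integral_sum Bochner_Integration.integral_add int)
    also have "\<dots> \<le> 2 * real s + (\<Sum>i<s. 2 * (real s - 1) + 2) / (real s * \<epsilon>) + real s / \<epsilon>"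
      using \<epsilon>(1) s0 EX EA Ecol
      by (intro add_mono divide_right_mono sum_mono mult_left_mono) auto
    also have "\<dots> = 2 * real s + 3 * real s / \<epsilon>"
      using s0 \<epsilon>(1) by (simp add: field_simps)
    finally show ?thesis .
  qed
  have "measure_pmf.prob ?R {vs. split_graph (induced G (set vs))} \<le>
      measure_pmf.prob ?R {vs \<in> space (measure_pmf ?R). 3 / 2 * \<epsilon> * (real s)\<^sup>2 \<le> Q vs}"
    by (rule measure_pmf.finite_measure_mono_AE)
       (use Q_ge in \<open>auto simp: AE_measure_pmf_iff set_replicate_pmf\<close>)
  also have "\<dots> \<le> ?E Q / (3 / 2 * \<epsilon> * (real s)\<^sup>2)"
  proof (rule integral_Markov_inequality_measure[of _ _ "{}"])
    show "AE vs in ?R. 0 \<le> Q vs"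
      using \<epsilon>(1) by (auto simp: Q_def col_def intro!: add_nonneg_nonneg sum_nonneg divide_nonneg_nonneg)
  qed (use int \<epsilon>(1) s0 in auto)
  also have "\<dots> \<le> (2 * real s + 3 * real s / \<epsilon>) / (3 / 2 * \<epsilon> * (real s)\<^sup>2)"
    using EQ \<epsilon>(1) by (intro divide_right_mono) auto
  also have "\<dots> \<le> 1 / 3"
  proof -
    have "10 \<le> real s * \<epsilon>\<^sup>2" using s \<epsilon>(1) by (simp add: field_simps)
    then have "4 * \<epsilon> + 6 \<le> real s * \<epsilon>\<^sup>2" using \<epsilon>(2) by linarith
    then have "real s * (4 * \<epsilon> + 6) \<le> real s * (real s * \<epsilon>\<^sup>2)" using s0 by (intro mult_left_mono) auto
    then show ?thesis using \<epsilon>(1) s0 by (simp add: field_simps power2_eq_square)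
  qed
  finally show ?thesis .
qed

section \<open>The tester\<close>

fun query_pairs :: "'v set \<Rightarrow> ('v \<times> 'v) list \<Rightarrow> 'v set set \<Rightarrow> 'v algorithm" where
  "query_pairs W [] E = Verdict (split_graph \<lparr>verts = W, edges = E\<rparr>)"
| "query_pairs W ((u, v) # ps) E = Query u v (\<lambda>b. query_pairs W ps (if b then insert {u, v} E else E))"

lemma run_query_pairs:
  "run (query_pairs W ps E) G S = return_pmf (Outcome
     (split_graph \<lparr>verts = W,
        edges = E \<union> {e \<in> edges G. \<exists>(u, v)\<in>set ps. u \<in> S \<and> v \<in> S \<and> e = {u, v}}\<rparr>)
     (length ps) 0)"
proof (induction ps arbitrary: E)
  case (Cons p ps)
  obtain u v where p: "p = (u, v)" by (cases p)
  let ?b = "u \<in> S \<and> v \<in> S \<and> {u, v} \<in> edges G"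
  have "(if ?b then insert {u, v} E else E) \<union>
        {e \<in> edges G. \<exists>(u, v)\<in>set ps. u \<in> S \<and> v \<in> S \<and> e = {u, v}} =
      E \<union> {e \<in> edges G. \<exists>(u, v)\<in>set (p # ps). u \<in> S \<and> v \<in> S \<and> e = {u, v}}"
    by (auto simp: p)
  then show ?case
    by (simp add: p Cons.IH)
qed simp

text \<open>
  Both kinds of reply are treated alike: only the set of revealed vertices matters. The linear order
  serves to list that set.
\<close>
definition split_tester :: "nat \<Rightarrow> 'v::linorder algorithm" where
  "split_tester s = Request s (\<lambda>r.
     let vs = sorted_list_of_set (revealed r) in query_pairs (revealed r) (List.product vs vs) {})"

lemma run_split_tester:
  assumes G: "simple_graph G"
  shows "run (split_tester s) G {} = map_pmf (\<lambda>r.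
    Outcome (split_graph (induced G (revealed r))) ((card (revealed r))\<^sup>2) (num_labels r)) (sample_oracle G s)"
proof -
  have fin: "finite (revealed r)" if "r \<in> set_pmf (sample_oracle G s)" for r
    using that G by (auto simp: sample_oracle_def simple_graph_def split: if_splits)
  have edges: "{e \<in> edges G. \<exists>(u, v)\<in>set (List.product (sorted_list_of_set W) (sorted_list_of_set W)).
      u \<in> W \<and> v \<in> W \<and> e = {u, v}} = {e \<in> edges G. e \<subseteq> W}" if "finite W" for W
  proof (intro Collect_cong conj_cong refl iffI)
    fix e assume "e \<in> edges G" "e \<subseteq> W"
    moreover from this G obtain u v where "e = {u, v}"
      by (auto simp: simple_graph_def card_2_iff)
    ultimately show "\<exists>(u, v)\<in>set (List.product (sorted_list_of_set W) (sorted_list_of_set W)).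
        u \<in> W \<and> v \<in> W \<and> e = {u, v}"
      using that by auto
  qed auto
  show ?thesis
    unfolding split_tester_def map_pmf_def[of _ "sample_oracle G s"] run.simps
    by (intro bind_pmf_cong refl)
       (simp add: fin Let_def run_query_pairs edges induced_def power2_eq_square del: set_product)
qed

lemma set_run_split_tester:
  assumes G: "simple_graph G" and x: "x \<in> set_pmf (run (split_tester s) G {})"
  shows "queries x \<le> s\<^sup>2" "labels x \<le> s" "split_graph G \<Longrightarrow> accepts x"
proof -
  obtain r where r: "r \<in> set_pmf (sample_oracle G s)"
    and x: "x = Outcome (split_graph (induced G (revealed r))) ((card (revealed r))\<^sup>2) (num_labels r)"
    using x by (auto simp: run_split_tester[OF G])
  have "revealed r \<subseteq> verts G \<and> card (revealed r) \<le> num_labels r \<and> num_labels r \<le> s"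
  proof (cases "s \<le> card (verts G)")
    case True
    then obtain vs where "r = Samples vs" "vs \<in> set_pmf (replicate_pmf s (pmf_of_set (verts G)))"
      using r by (auto simp: sample_oracle_def)
    moreover from this(2) have "set vs \<subseteq> verts G" if "verts G \<noteq> {}"
      using that G by (auto simp: set_replicate_pmf simple_graph_def)
    moreover have "s = 0" if "verts G = {}" using True that by simp
    ultimately show ?thesis
      by (cases "verts G = {}") (auto simp: set_replicate_pmf card_length)
  next
    case False
    then show ?thesis using r by (auto simp: sample_oracle_def)
  qed
  then show "queries x \<le> s\<^sup>2" "labels x \<le> s" "split_graph G \<Longrightarrow> accepts x"
    by (auto simp: x split_graph_induced intro: power_mono)
qed

lemma query_complexity_split_tester: "query_complexity (split_tester s) \<le> enat (s\<^sup>2)"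
  unfolding query_complexity_def by (auto intro!: SUP_least set_run_split_tester)

lemma sample_complexity_split_tester: "sample_complexity (split_tester s) \<le> enat s"
  unfolding sample_complexity_def by (auto intro!: SUP_least set_run_split_tester)

lemma split_tester_accepts:
  assumes "split_graph G"
  shows "prob_accept (split_tester s) G = 1"
proof -
  have "simple_graph G" using assms by (simp add: split_graph_def)
  then show ?thesis
    unfolding prob_accept_def
    by (subst measure_pmf.prob_eq_1) (auto simp: AE_measure_pmf_iff assms set_run_split_tester)
qed

text \<open>
  The threshold \<open>t\<close> of \<open>far_from_split_threshold\<close>, divided by the number of vertices, in the language of expectations.
\<close>
lemma far_from_split_gap:
  assumes G: "simple_graph G" and far: "far_from split_graph \<epsilon> G" and ne: "verts G \<noteq> {}"
  defines "p \<equiv> pmf_of_set (verts G)"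
  obtains \<theta> where "0 \<le> \<theta>" "\<theta> \<le> 1"
    "2 * \<epsilon> \<le> \<theta> * (1 - \<theta>) -
      measure_pmf.expectation p (\<lambda>v. \<bar>measure_pmf.expectation p (adj G v) - \<theta>\<bar>)"
proof -
  define n where "n = real (card (verts G))"
  have fin: "finite (verts G)" using G by (simp add: simple_graph_def)
  have n: "0 < n" using fin ne by (simp add: n_def card_gt_0_iff)
  obtain t where t: "0 \<le> t" "t \<le> n"
    and gap: "2 * \<epsilon> * n\<^sup>2 < t * (n - t) - (\<Sum>v\<in>verts G. \<bar>(\<Sum>w\<in>verts G. adj G v w) - t\<bar>)"
    using far_from_split_threshold[OF G far ne] unfolding n_def by blast
  have E: "measure_pmf.expectation p f = (\<Sum>v\<in>verts G. f v) / n" for f :: "'a \<Rightarrow> real"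
    using fin ne by (simp add: p_def n_def integral_pmf_of_set)
  have "(\<Sum>v\<in>verts G. \<bar>(\<Sum>w\<in>verts G. adj G v w) / n - t / n\<bar>) =
      (\<Sum>v\<in>verts G. \<bar>(\<Sum>w\<in>verts G. adj G v w) - t\<bar>) / n"
    unfolding sum_divide_distrib[of "\<lambda>v. \<bar>_ v\<bar>"] diff_divide_distrib[symmetric]
    using n by (simp add: abs_divide)
  then have "t / n * (1 - t / n) -
      measure_pmf.expectation p (\<lambda>v. \<bar>measure_pmf.expectation p (adj G v) - t / n\<bar>) =
      (t * (n - t) - (\<Sum>v\<in>verts G. \<bar>(\<Sum>w\<in>verts G. adj G v w) - t\<bar>)) / n\<^sup>2"
    using n by (simp add: E) (simp add: field_simps power2_eq_square)
  also have "2 * \<epsilon> \<le> \<dots>"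
    using gap n by (simp add: field_simps)
  finally show thesis
    using that[of "t / n"] t n by simp
qed

lemma split_tester_rejects:
  fixes \<epsilon> :: real
  assumes G: "simple_graph G" and far: "far_from split_graph \<epsilon> G" and \<epsilon>: "0 < \<epsilon>" and s: "10 / \<epsilon>\<^sup>2 \<le> real s"
  shows "2 / 3 \<le> prob_reject (split_tester s) G"
proof (cases "s \<le> card (verts G)")
  case True
  define p where "p = pmf_of_set (verts G)"
  have "0 < 10 / \<epsilon>\<^sup>2" using \<epsilon> by simp
  then have s0: "0 < s" using s by linarith
  have fin: "finite (verts G)" using G by (simp add: simple_graph_def)
  have ne: "verts G \<noteq> {}" using True s0 by auto
  obtain \<theta> where \<theta>: "0 \<le> \<theta>" "\<theta> \<le> 1" and gap: "2 * \<epsilon> \<le> \<theta> * (1 - \<theta>) -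
      measure_pmf.expectation p (\<lambda>v. \<bar>measure_pmf.expectation p (adj G v) - \<theta>\<bar>)"
    using far_from_split_gap[OF G far ne] unfolding p_def by blast
  \<comment> \<open>No graph is far from being split for \<open>\<epsilon> > 1\<close>, as the gap itself shows.\<close>
  have "2 * \<epsilon> \<le> \<theta> * (1 - \<theta>)"
    using gap Bochner_Integration.integral_nonneg[of p "\<lambda>v. \<bar>measure_pmf.expectation p (adj G v) - \<theta>\<bar>"]
    by linarith
  also have "\<dots> \<le> 1" using \<theta> by (simp add: mult_le_one)
  finally have \<epsilon>1: "\<epsilon> \<le> 1" by simp
  have "pmf p x \<le> 1 / real s" for x
    using True s0 fin ne by (auto simp: p_def indicator_def intro!: divide_left_mono)
  then have "measure_pmf.prob (replicate_pmf s p) {vs. split_graph (induced G (set vs))} \<le> 1/3"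
    using prob_split_sample_le[OF G _ \<epsilon> \<epsilon>1 s _ \<theta> gap] fin ne by (simp add: p_def)
  moreover have "prob_reject (split_tester s) G =
      measure_pmf.prob (replicate_pmf s p) (- {vs. split_graph (induced G (set vs))})"
    using True by (simp add: prob_reject_def run_split_tester[OF G] sample_oracle_def p_def
        vimage_def Compl_eq)
  ultimately show ?thesis
    using measure_pmf.prob_compl[of "{vs. split_graph (induced G (set vs))}" "replicate_pmf s p"]
    by (simp add: Compl_eq_Diff_UNIV)
next
  case False
  \<comment> \<open>The whole graph is inspected, and it is not split, its distance to itself being zero.\<close>
  have "induced G (verts G) = G"
    using G by (cases G) (auto simp: induced_def simple_graph_def)
  moreover have "\<not> split_graph G"
    using far G \<epsilon> by (force simp: far_from_def graph_dist_def)
  ultimately show ?thesis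
    using False by (simp add: prob_reject_def run_split_tester[OF G] sample_oracle_def)
qed

theorem corollary5p5:
  "\<exists>T :: real \<Rightarrow> nat algorithm.
     size_oblivious_tester split_graph T \<and>
     one_sided_error split_graph T \<and>
     (\<lambda>\<epsilon>. real (the_enat (query_complexity (T \<epsilon>)))) \<in> soft_bigo (at_right 0) (\<lambda>\<epsilon>. 1 / \<epsilon> ^ 6)"
proof -
  define s where "s \<epsilon> = nat \<lceil>10 / \<epsilon>\<^sup>2\<rceil>" for \<epsilon> :: real
  define T :: "real \<Rightarrow> nat algorithm" where "T \<epsilon> = split_tester (s \<epsilon>)" for \<epsilon>
  have s: "10 / \<epsilon>\<^sup>2 \<le> real (s \<epsilon>)" for \<epsilon>
    by (simp add: s_def real_nat_ceiling_ge)
  have "size_oblivious_tester split_graph T"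
    unfolding size_oblivious_tester_def
  proof (intro allI impI conjI)
    fix \<epsilon> :: real assume \<epsilon>: "0 < \<epsilon>"
    show "query_complexity (T \<epsilon>) < \<infinity>" "sample_complexity (T \<epsilon>) < \<infinity>"
      using query_complexity_split_tester[of "s \<epsilon>"] sample_complexity_split_tester[of "s \<epsilon>"]
        enat_ord_code(4) order.strict_trans1 unfolding T_def by blast+
    fix G :: "nat ugraph" assume G: "simple_graph G"
    show "2 / 3 \<le> prob_accept (T \<epsilon>) G" if "split_graph G"
      using split_tester_accepts[OF that] by (simp add: T_def)
    show "2 / 3 \<le> prob_reject (T \<epsilon>) G" if "far_from split_graph \<epsilon> G"
      using split_tester_rejects[OF G that \<epsilon> s] by (simp add: T_def)
  qed
  moreover have "one_sided_error split_graph T"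
    by (simp add: one_sided_error_def T_def split_tester_accepts)
  moreover have "(\<lambda>\<epsilon>. real (the_enat (query_complexity (T \<epsilon>)))) \<in> O[at_right 0](\<lambda>\<epsilon>. 1 / \<epsilon> ^ 6)"
  \<comment> \<open>As \<open>s \<le> 11 / \<epsilon>\<^sup>2 \<le> 11 / \<epsilon>\<^sup>3\<close> for \<open>\<epsilon> < 1\<close>, the number of queries is at most \<open>121 / \<epsilon>\<^sup>6\<close>.\<close>
  proof (rule bigoI[of _ 121])
    have "eventually (\<lambda>\<epsilon>::real. \<epsilon> \<in> {0<..<1}) (at_right 0)"
      by (rule eventually_at_right_real) simp
    then show "\<forall>\<^sub>F \<epsilon> in at_right 0. norm (real (the_enat (query_complexity (T \<epsilon>)))) \<le> 121 * norm (1 / \<epsilon> ^ 6 :: real)"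
    proof eventually_elim
      case (elim \<epsilon>)
      have "query_complexity (T \<epsilon>) \<le> enat ((s \<epsilon>)\<^sup>2)"
        by (simp add: T_def query_complexity_split_tester)
      then have "the_enat (query_complexity (T \<epsilon>)) \<le> (s \<epsilon>)\<^sup>2"
        by (cases "query_complexity (T \<epsilon>)") auto
      then have "real (the_enat (query_complexity (T \<epsilon>))) \<le> (real (s \<epsilon>))\<^sup>2"
        by (metis of_nat_le_iff of_nat_power)
      also have "\<dots> \<le> (11 / \<epsilon> ^ 3)\<^sup>2"
      proof (rule power_mono)
        have "real (s \<epsilon>) \<le> 10 / \<epsilon>\<^sup>2 + 1"
          unfolding s_def by simp
        also have "10 / \<epsilon>\<^sup>2 \<le> 10 / \<epsilon> ^ 3"
          using elim by (intro divide_left_mono power_decreasing) auto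
        also have "1 \<le> 1 / \<epsilon> ^ 3"
          using elim by (simp add: power_le_one)
        finally show "real (s \<epsilon>) \<le> 11 / \<epsilon> ^ 3" by simp
      qed simp
      also have "\<dots> = 121 * norm (1 / \<epsilon> ^ 6)"
        using elim by (simp add: power_divide power_mult[symmetric])
      finally show ?case by simp
    qed
  qed
  then have "(\<lambda>\<epsilon>. real (the_enat (query_complexity (T \<epsilon>)))) \<in> soft_bigo (at_right 0) (\<lambda>\<epsilon>. 1 / \<epsilon> ^ 6)"
    unfolding soft_bigo_def by (intro UN_I[of 0]) simp_all
  ultimately show ?thesis by blast
qed

end
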